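(* Let $G$ be a simple undirected graph on $n\ge 5$ vertices, and let $k$ be an integer with $4\le k\le n-1$. Suppose that $G$ contains the complete graph $K_k$ as an induced subgraph. Let $\mathbb{F}$ be a finite non-prime field of characteristic $p$ (that is, $\mathbb{F}$ is a finite field of characteristic $p$ whose number of elements is not $p$). Then $\mathrm{mr}(\mathbb{F},G)\le n-k+1$.
   Context: For a field $\mathbb{F}$ and a simple undirected graph $G$ with vertex set $\{1,\ldots,n\}$ and edge set $E$, let $\mathrm{S}(\mathbb{F},G)$ denote the set of all symmetric $n\times n$ matrices $A=[a_{ij}]$ over $\mathbb{F}$ such that, for all $i\neq j$, $a_{ij}\neq 0$ if and only if $ij\in E$; there is no restriction on the diagonal entries. The minimum rank of $G$ over $\mathbb{F}$ is $\mathrm{mr}(\mathbb{F},G)=\min\{\operatorname{rank}A : A\in \mathrm{S}(\mathbb{F},G)\}$. *)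

theory Defs
  imports
    "HOL-Library.Cardinality"
    "Jordan_Normal_Form.DL_Rank"
    "Graph_Theory.Graph_Theory"
begin

text \<open>
  Simple undirected graphs are rendered by the locale \<^locale>\<open>graph\<close> (finite, loop-free, symmetric
  digraphs without parallel arcs): the edge \<open>ij\<close> is the pair of arcs \<open>(i,j)\<close>, \<open>(j,i)\<close>.
  Matrix indices start at 0, so the definitions below are meant for graphs with
  vertex set \<open>{0..<n}\<close>, which plays the role of \<open>{1,\<dots>,n}\<close>.
\<close>

definition graph_mats :: "'a::field itself \<Rightarrow> (nat, 'b) pre_digraph \<Rightarrow> 'a mat set" where
  "graph_mats F G =
    {A \<in> carrier_mat (card (verts G)) (card (verts G)).
      A\<^sup>T = A \<and>
      (\<forall>i < card (verts G). \<forall>j < card (verts G). i \<noteq> j \<longrightarrow> (A $$ (i, j) \<noteq> 0 \<longleftrightarrow> i \<rightarrow>\<^bsub>G\<^esub> j))}"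

definition min_rank :: "'a::field itself \<Rightarrow> (nat, 'b) pre_digraph \<Rightarrow> nat" where
  "min_rank F G = (LEAST r. \<exists>A \<in> graph_mats F G. r = vec_space.rank (card (verts G)) A)"

text \<open>The minimum is taken over a nonempty set, so it is attained.\<close>

lemma graph_mats_nonempty:
  assumes "graph G"
  shows "graph_mats TYPE('a::field) G \<noteq> {}"
proof -
  interpret graph G by fact
  let ?n = "card (verts G)"
  let ?A = "mat ?n ?n (\<lambda>(i, j). if i \<rightarrow>\<^bsub>G\<^esub> j then 1 else (0 :: 'a))"
  have "i \<rightarrow>\<^bsub>G\<^esub> j \<longleftrightarrow> j \<rightarrow>\<^bsub>G\<^esub> i" for i j
    using sym_arcs by (auto simp: symmetric_def dest: symD)
  then have "?A \<in> graph_mats TYPE('a) G"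
    by (auto simp: graph_mats_def intro!: eq_matI)
  then show ?thesis by blast
qed

lemma min_rank_attained:
  assumes "graph G"
  shows "\<exists>A \<in> graph_mats TYPE('a::field) G.
    min_rank TYPE('a) G = vec_space.rank (card (verts G)) A"
proof -
  have "\<exists>r. \<exists>A \<in> graph_mats TYPE('a) G. r = vec_space.rank (card (verts G)) A"
    using graph_mats_nonempty[OF assms] by blast
  then show ?thesis unfolding min_rank_def by (rule LeastI_ex)
qed

end

theory Submission
  imports Defs "HOL-Number_Theory.Residues"
begin

text \<open>
  Let \<open>W\<close> be the set of the \<open>n - k\<close> vertices outside the clique. Eliminating the vertices of \<open>W\<close>
  one at a time yields vectors \<open>v\<^sub>w\<close> over the prime field such that \<open>\<Sum>w\<in>W. v\<^sub>w v\<^sub>w\<^sup>T\<close>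
  agrees with the adjacency matrix at all off-diagonal positions that meet \<open>W\<close>. Inside the clique the
  entries of this sum lie in the prime field, so adding \<open>\<alpha> u u\<^sup>T\<close>, where \<open>u\<close> is the indicator
  of the clique and \<open>\<alpha>\<close> lies outside the prime field, makes all of them nonzero.
\<close>

text \<open>\<open>of_int z\<close> depends only on \<open>z\<close> modulo the characteristic, so
  \<int>, the prime subring, has at most \<open>CHAR('a)\<close> elements. As the characteristic
  divides the cardinality of the ring, \<int> could exhaust the ring only if the two were
  equal.\<close>

lemma Ints_neq_UNIV_of_CARD_neq_CHAR:
  assumes "CARD('a::{ring_1,finite}) \<noteq> CHAR('a)"
  shows "(\<int> :: 'a set) \<noteq> UNIV"
proof
  assume UNIV: "(\<int> :: 'a set) = UNIV"
  have pos: "CHAR('a) > 0"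
    by (rule finite_imp_CHAR_pos) simp
  have "(\<int> :: 'a set) \<subseteq> of_int ` {0..<int CHAR('a)}"
  proof
    fix x :: 'a assume "x \<in> \<int>"
    then obtain z where "x = of_int z" by (rule Ints_cases)
    also have "of_int z = (of_int (z mod int CHAR('a)) :: 'a)"
      by (simp add: of_int_eq_iff_cong_CHAR cong_def)
    finally show "x \<in> of_int ` {0..<int CHAR('a)}"
      using pos by auto
  qed
  then have "CARD('a) \<le> card {0..<int CHAR('a)}"
    unfolding UNIV by (rule surj_card_le[rotated]) simp
  moreover have "CHAR('a) \<le> CARD('a)"
    by (rule dvd_imp_le) (simp_all add: CHAR_dvd_CARD card_gt_0_iff)
  ultimately show False using assms by simp
qed

lemma (in vec_space) rank_sum_outer_products_le:
  fixes f g :: "'i \<Rightarrow> nat \<Rightarrow> 'a"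
  assumes "finite S"
  shows "rank (mat n nc (\<lambda>(i, j). \<Sum>x\<in>S. f x i * g x j)) \<le> card S"
  using assms
proof (induction S rule: finite_induct)
  case empty
  have "mat n nc (\<lambda>(i, j). \<Sum>x\<in>{}. f x i * g x j) = 0\<^sub>m n nc"
    by (rule eq_matI) auto
  then show ?case by (simp only: rank_0I card.empty)
next
  case (insert y S)
  let ?A = "mat n nc (\<lambda>(i, j). f y i * g y j)"
  let ?B = "mat n nc (\<lambda>(i, j). \<Sum>x\<in>S. f x i * g x j)"
  have "mat n nc (\<lambda>(i, j). \<Sum>x\<in>insert y S. f x i * g x j) = ?A + ?B"
    using insert.hyps by (intro eq_matI) auto
  moreover have "rank (?A + ?B) \<le> rank ?A + rank ?B"
    by (rule rank_subadditive) auto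
  moreover have "rank ?A \<le> 1"
    by (rule rank_le_1_product_entries) auto
  ultimately show ?case using insert by simp
qed

text \<open>Symmetric elimination, one pivot per element of \<open>W\<close>. Diagonal entries are
  left unconstrained, so every pivot can be taken to be 1; hence nothing is ever divided and all
  entries stay in \<int>.\<close>

lemma ex_sum_outer_products_eq_off_diagonal:
  fixes T :: "'v \<Rightarrow> 'v \<Rightarrow> 'a::comm_ring_1"
  assumes "finite W"
    and "\<And>i j. T i j = T j i"
    and "\<And>i j. T i j \<in> \<int>"
  shows "\<exists>v :: 'v \<Rightarrow> 'v \<Rightarrow> 'a. (\<forall>w i. v w i \<in> \<int>) \<and>
    (\<forall>i j. i \<in> W \<longrightarrow> i \<noteq> j \<longrightarrow> (\<Sum>w\<in>W. v w i * v w j) = T i j)"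
  using assms
proof (induction W arbitrary: T rule: finite_induct)
  case empty
  show ?case by (intro exI[of _ "\<lambda>_ _. 0"]) auto
next
  case (insert y W)
  \<comment> \<open>Away from row and column \<open>y\<close>, this is the Schur complement of
    \<open>T\<close> with the pivot \<open>T y y\<close> replaced by 1.\<close>
  define T' where "T' i j = T i j - T y i * T y j" for i j
  have "\<exists>v :: 'v \<Rightarrow> 'v \<Rightarrow> 'a. (\<forall>w i. v w i \<in> \<int>) \<and>
    (\<forall>i j. i \<in> W \<longrightarrow> i \<noteq> j \<longrightarrow> (\<Sum>w\<in>W. v w i * v w j) = T' i j)"
  proof (rule insert.IH)
    show "T' i j = T' j i" for i j
      using insert.prems(1)[of i j] by (simp add: T'_def mult.commute)
    show "T' i j \<in> \<int>" for i j
      using insert.prems(2) by (simp add: T'_def)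
  qed
  then obtain v :: "'v \<Rightarrow> 'v \<Rightarrow> 'a" where v_Ints: "\<And>w i. v w i \<in> \<int>"
    and v_sum: "\<And>i j. i \<in> W \<Longrightarrow> i \<noteq> j \<Longrightarrow> (\<Sum>w\<in>W. v w i * v w j) = T' i j"
    by blast
  \<comment> \<open>The new vector is row \<open>y\<close> of \<open>T\<close> with its diagonal
    entry set to 1. The old vectors get coordinate \<open>y\<close> zeroed, so row and column
    \<open>y\<close> come from the new vector alone; elsewhere it adds back the product subtracted
    in \<open>T'\<close>.\<close>
  define v' where "v' w i =
    (if w = y then if i = y then 1 else T y i else if i = y then 0 else v w i)" for w i
  have sum_v': "(\<Sum>w\<in>W. v' w i * v' w j) =
      (if i = y \<or> j = y then 0 else \<Sum>w\<in>W. v w i * v w j)" for i j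
  proof -
    have "(\<Sum>w\<in>W. v' w i * v' w j) =
        (\<Sum>w\<in>W. if i = y \<or> j = y then 0 else v w i * v w j)"
      using insert.hyps by (intro sum.cong) (auto simp: v'_def)
    then show ?thesis by simp
  qed
  have "(\<Sum>w\<in>insert y W. v' w i * v' w j) = T i j" if "i \<in> insert y W" "i \<noteq> j" for i j
    \<comment> \<open>For \<open>j = y\<close> the sum is \<open>T y i\<close>, so symmetry of
      \<open>T\<close> is needed to reach \<open>T i y\<close>.\<close>
    using that insert.hyps insert.prems(1)[of i y] v_sum[of i j]
    by (auto simp: sum_v') (auto simp: v'_def T'_def)
  moreover have "v' w i \<in> \<int>" for w i
    using insert.prems(2) v_Ints by (simp add: v'_def)
  ultimately show ?case by blast
qed

theorem theorem5p1:
  fixes G :: "(nat, 'b) pre_digraph" and n k p :: nat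
  assumes "graph G" and "verts G = {0..<n}" and "n \<ge> 5"
    and "4 \<le> k" and "k \<le> n - 1"
    and "\<exists>H. induced_subgraph H G \<and> complete_digraph k H"
    and "CHAR('a::{field,finite}) = p" and "CARD('a) \<noteq> p"
  shows "min_rank TYPE('a) G \<le> n - k + 1"
proof -
  interpret graph G by fact
  obtain H where H: "induced_subgraph H G" "complete_digraph k H"
    using assms(6) by blast
  define K where "K = verts H"
  define W where "W = {0..<n} - K"
  have K_sub: "K \<subseteq> {0..<n}"
    using H(1) assms(2) by (auto simp: K_def induced_subgraph_def subgraph_def)
  have "card K = k"
    using H(2) by (simp add: K_def complete_digraph_def)
  then have card_W: "card W = n - k"
    using K_sub by (simp add: W_def card_Diff_subset finite_subset)
  have clique: "i \<rightarrow>\<^bsub>G\<^esub> j" if "i \<in> K" "j \<in> K" "i \<noteq> j" for i j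
  proof -
    have "i \<rightarrow>\<^bsub>H\<^esub> j"
      using H(2) that by (simp add: K_def complete_digraph_def)
    moreover have "subgraph H G"
      using H(1) by (simp add: induced_subgraph_def)
    ultimately show ?thesis by (rule adj_mono)
  qed
  have adj_sym: "i \<rightarrow>\<^bsub>G\<^esub> j \<longleftrightarrow> j \<rightarrow>\<^bsub>G\<^esub> i" for i j
    using sym_arcs by (auto simp: symmetric_def dest: symD)
  define T :: "nat \<Rightarrow> nat \<Rightarrow> 'a" where "T i j = (if i \<rightarrow>\<^bsub>G\<^esub> j then 1 else 0)" for i j
  have "\<exists>v :: nat \<Rightarrow> nat \<Rightarrow> 'a. (\<forall>w i. v w i \<in> \<int>) \<and>
      (\<forall>i j. i \<in> W \<longrightarrow> i \<noteq> j \<longrightarrow> (\<Sum>w\<in>W. v w i * v w j) = T i j)"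
    by (rule ex_sum_outer_products_eq_off_diagonal) (use adj_sym in \<open>auto simp: W_def T_def\<close>)
  then obtain v :: "nat \<Rightarrow> nat \<Rightarrow> 'a" where v_Ints: "\<And>w i. v w i \<in> \<int>"
    and v_sum: "\<And>i j. i \<in> W \<Longrightarrow> i \<noteq> j \<Longrightarrow> (\<Sum>w\<in>W. v w i * v w j) = T i j"
    by blast
  obtain \<alpha> :: 'a where \<alpha>: "\<alpha> \<notin> \<int>"
    using Ints_neq_UNIV_of_CARD_neq_CHAR assms(7,8) by blast
  define M where "M i j = (\<Sum>w\<in>W. v w i * v w j)" for i j
  define u :: "nat \<Rightarrow> 'a" where "u i = (if i \<in> K then 1 else 0)" for i
  have M_sym: "M i j = M j i" for i j
    by (simp add: M_def mult.commute)
  have M_Ints: "M i j \<in> \<int>" for i j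
    unfolding M_def by (intro Ints_sum Ints_mult v_Ints)
  \<comment> \<open>\<open>?B\<close> contributes rank at most 1, and \<open>?C\<close> at most one
    per vertex outside the clique.\<close>
  let ?B = "mat n n (\<lambda>(i, j). \<alpha> * u i * u j)" and ?C = "mat n n (\<lambda>(i, j). M i j)"
  have entry: "\<alpha> * u i * u j + M i j \<noteq> 0 \<longleftrightarrow> i \<rightarrow>\<^bsub>G\<^esub> j" if "i < n" "j < n" "i \<noteq> j" for i j
  proof (cases "i \<in> K \<and> j \<in> K")
    case True
    have "\<alpha> + M i j \<noteq> 0"
    proof
      assume "\<alpha> + M i j = 0"
      then have "\<alpha> = - M i j" by (simp add: eq_neg_iff_add_eq_0)
      then show False using \<alpha> M_Ints[of i j] by simp
    qed
    then show ?thesis using True clique that by (simp add: u_def)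
  next
    case False
    then have "i \<in> W \<or> j \<in> W" using that by (auto simp: W_def)
    \<comment> \<open>\<open>v_sum\<close> wants its first index in \<open>W\<close>; if only
      \<open>j\<close> lies there, symmetry of \<open>M\<close> and of adjacency swaps the
      indices.\<close>
    then have "M i j = T i j"
      using v_sum[of i j] v_sum[of j i] M_sym[of i j] adj_sym[of i j] that(3)
      by (auto simp: M_def T_def)
    then show ?thesis using False by (auto simp: u_def T_def)
  qed
  have "?B + ?C \<in> graph_mats TYPE('a) G"
    using entry M_sym by (auto simp: graph_mats_def assms(2) intro!: eq_matI)
  then have "min_rank TYPE('a) G \<le> vec_space.rank n (?B + ?C)"
    unfolding min_rank_def by (intro Least_le) (auto simp: assms(2))
  also have "\<dots> \<le> vec_space.rank n ?B + vec_space.rank n ?C"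
    by (rule vec_space.rank_subadditive) auto
  also have "vec_space.rank n ?B \<le> 1"
    \<comment> \<open>The scalar \<alpha> is absorbed into the row factor.\<close>
    by (rule vec_space.rank_le_1_product_entries[of _ _ n "\<lambda>i. \<alpha> * u i" u]) auto
  also have "vec_space.rank n ?C \<le> card W"
    unfolding M_def by (rule vec_space.rank_sum_outer_products_le) (simp add: W_def)
  finally show ?thesis using card_W by simp
qed

end
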